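(* All Ulam sets in $\mathbb{Z}\times (\mathbb{Z}/2\mathbb{Z})$, $\mathbb{Z}\times (\mathbb{Z}/3\mathbb{Z})$ and $\mathbb{Z}\times (\mathbb{Z}/4\mathbb{Z})$ are infinite.
   Context: For a positive integer $n$, an Ulam set in $\mathbb{Z}\times(\mathbb{Z}/n\mathbb{Z})$ is a set $\mathcal{U}(S)$ obtained from a finite initial set $S\subset \mathbb{Z}\times(\mathbb{Z}/n\mathbb{Z})$ all of whose elements have strictly positive first coordinate, as follows. The size of $(x,y)$ is $x$. First put the elements of $S$ into $\mathcal{U}(S)$; then repeatedly add a smallest (in size) element not already in $\mathcal{U}(S)$ that is uniquely represented as the sum of two distinct elements already in $\mathcal{U}(S)$ (with $p+q$ and $q+p$ considered the same representation). Ties in size may be broken arbitrarily without affecting the resulting set.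
   Formalization: The initial set S is assumed to have at least two elements; if S has at most one element, such as S = {(1,0)}, there is no sum of two distinct elements, so the Ulam set equals S and is finite. *)

theory Defs
  imports "HOL-Algebra.Elementary_Groups"
begin

abbreviation int_cyl :: "nat \<Rightarrow> (int \<times> int) monoid" where
  "int_cyl n \<equiv> integer_group \<times>\<times> integer_mod_group n"

definition ulam_initial :: "nat \<Rightarrow> (int \<times> int) set \<Rightarrow> bool" where
  "ulam_initial n S \<longleftrightarrow> finite S \<and> S \<subseteq> carrier (int_cyl n) \<and> (\<forall>p\<in>S. 0 < fst p)"

text \<open>Representations are unordered pairs, so \<open>p + q\<close> and \<open>q + p\<close> count once.\<close>

definition uniquely_represented :: "nat \<Rightarrow> (int \<times> int) set \<Rightarrow> int \<times> int \<Rightarrow> bool" where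
  "uniquely_represented n A z \<longleftrightarrow>
     (\<exists>!P. \<exists>p\<in>A. \<exists>q\<in>A. p \<noteq> q \<and> P = {p, q} \<and> p \<otimes>\<^bsub>int_cyl n\<^esub> q = z)"

definition ulam_candidate :: "nat \<Rightarrow> (int \<times> int) set \<Rightarrow> int \<times> int \<Rightarrow> bool" where
  "ulam_candidate n A z \<longleftrightarrow>
     z \<in> carrier (int_cyl n) \<and> z \<notin> A \<and> uniquely_represented n A z"

text \<open>One step of the construction. It is a relation because ties in size may be broken
  arbitrarily; once there is no candidate left, the set no longer changes.\<close>

definition ulam_step :: "nat \<Rightarrow> (int \<times> int) set \<Rightarrow> (int \<times> int) set \<Rightarrow> bool" where
  "ulam_step n A B \<longleftrightarrow>
     (if \<exists>z. ulam_candidate n A z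
      then \<exists>z. is_arg_min fst (ulam_candidate n A) z \<and> B = insert z A
      else B = A)"

text \<open>\<open>ulam_set n S U\<close>: some run of the construction started at \<open>S\<close> produces \<open>U\<close>.\<close>

definition ulam_set :: "nat \<Rightarrow> (int \<times> int) set \<Rightarrow> (int \<times> int) set \<Rightarrow> bool" where
  "ulam_set n S U \<longleftrightarrow>
     ulam_initial n S \<and>
     (\<exists>T :: nat \<Rightarrow> (int \<times> int) set.
        T 0 = S \<and> (\<forall>k. ulam_step n (T k) (T (Suc k))) \<and> U = (\<Union>k. T k))"

lemma ulam_candidate_pos:
  assumes "\<forall>p\<in>A. 0 < fst p" "ulam_candidate n A z"
  shows "0 < fst z"
proof -
  obtain p q where pq: "p \<in> A" "q \<in> A" "p \<otimes>\<^bsub>int_cyl n\<^esub> q = z"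
    using assms(2) unfolding ulam_candidate_def uniquely_represented_def by blast
  then have "fst z = fst p + fst q"
    by (cases p; cases q) (auto simp: DirProd_def integer_group_def)
  moreover have "0 < fst p" "0 < fst q" using pq assms(1) by blast+
  ultimately show ?thesis by linarith
qed

lemma ulam_step_exists:
  assumes pos: "\<forall>p\<in>A. 0 < fst p"
  shows "\<exists>B. (\<forall>p\<in>B. 0 < fst p) \<and> ulam_step n A B"
proof (cases "\<exists>z. ulam_candidate n A z")
  case True
  then obtain z0 where z0: "ulam_candidate n A z0" by blast
  obtain z where cz: "ulam_candidate n A z"
    and least: "\<And>y. ulam_candidate n A y \<Longrightarrow> nat (fst z) \<le> nat (fst y)"
    using exists_least_iff[of "\<lambda>m. \<exists>z. ulam_candidate n A z \<and> nat (fst z) = m"] z0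
    by (metis not_less)
  have "fst z \<le> fst y" if "ulam_candidate n A y" for y
    using least[OF that] ulam_candidate_pos[OF pos that] by linarith
  then have "is_arg_min fst (ulam_candidate n A) z"
    using cz by (auto simp: is_arg_min_def not_less)
  then have "ulam_step n A (insert z A)"
    unfolding ulam_step_def if_P[OF True] by blast
  moreover have "\<forall>p\<in>insert z A. 0 < fst p"
    using pos ulam_candidate_pos[OF pos cz] by blast
  ultimately show ?thesis by blast
next
  case False
  then show ?thesis using pos unfolding ulam_step_def by auto
qed

lemma ulam_set_exists:
  assumes "ulam_initial n S"
  shows "\<exists>U. ulam_set n S U"
proof -
  have pos: "\<forall>p\<in>S. 0 < fst p" using assms by (simp add: ulam_initial_def)
  have "\<exists>T. \<forall>k. ((\<forall>p\<in>T k. 0 < fst p) \<and> (k = 0 \<longrightarrow> T k = S)) \<and> ulam_step n (T k) (T (Suc k))"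
  proof (rule dependent_nat_choice)
    show "\<exists>A. (\<forall>p\<in>A. 0 < fst p) \<and> ((0::nat) = 0 \<longrightarrow> A = S)"
      using pos by blast
  next
    fix A :: "(int \<times> int) set" and k :: nat
    assume "(\<forall>p\<in>A. 0 < fst p) \<and> (k = 0 \<longrightarrow> A = S)"
    then obtain B where "\<forall>p\<in>B. 0 < fst p" "ulam_step n A B"
      using ulam_step_exists by blast
    then show "\<exists>B. ((\<forall>p\<in>B. 0 < fst p) \<and> (Suc k = 0 \<longrightarrow> B = S)) \<and> ulam_step n A B"
      by auto
  qed
  then obtain T where "T 0 = S" "\<forall>k. ulam_step n (T k) (T (Suc k))" by blast
  then show ?thesis using assms unfolding ulam_set_def by blast
qed

text \<open>With fewer than two initial elements there are no sums of two distinct elements, so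
  the construction is stationary.\<close>

lemma ulam_set_degenerate:
  assumes "ulam_set n S U" "card S < 2"
  shows "U = S"
proof -
  obtain T where T: "T 0 = S" "\<And>k. ulam_step n (T k) (T (Suc k))" "U = (\<Union>k. T k)"
    using assms(1) unfolding ulam_set_def by blast
  have "finite S" using assms(1) by (simp add: ulam_set_def ulam_initial_def)
  then have "\<forall>p\<in>S. \<forall>q\<in>S. p = q"
    using assms(2) card_le_Suc0_iff_eq[of S] by simp
  then have none: "\<not> ulam_candidate n S z" for z
    unfolding ulam_candidate_def uniquely_represented_def by blast
  have "T k = S" for k
  proof (induction k)
    case 0
    show ?case by (fact T(1))
  next
    case (Suc k)
    then show ?case using T(2)[of k] none by (simp add: ulam_step_def)
  qed
  then show ?thesis using T(3) by simp
qed

end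

theory Submission
  imports Defs
begin

text \<open>An Ulam set can only be finite if the construction reaches a finite set without a candidate,
  so it suffices that every finite set \<open>A\<close> of at least two elements of positive size has one.
  Look at the elements of maximal size \<open>M\<close> in \<open>A\<close>. If there is only one, say \<open>p\<close>, and \<open>q\<close> is a
  largest remaining element, then a sum of two distinct elements can only have the size of \<open>p + q\<close>
  if one summand is \<open>p\<close>, so \<open>p + q\<close> is uniquely represented by cancellation. If there are several,
  then a sum of size \<open>2 * M\<close> only involves elements of size \<open>M\<close>, and the problem becomes one about
  the set \<open>Y\<close> of their second coordinates: some sum of two distinct elements of \<open>Y\<close> must be
  uniquely represented. This is where \<open>n \<le> 4\<close> enters: two different pairs with the same sum are
  disjoint, so they can only occur when \<open>n = 4\<close> and \<open>Y\<close> is the whole group, and there \<open>0 + 2\<close> is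
  uniquely represented. In both cases the sum is larger than \<open>M\<close>, hence not in \<open>A\<close>.\<close>

lemma mult_int_cyl:
  "0 < n \<Longrightarrow> p \<otimes>\<^bsub>int_cyl n\<^esub> q = (fst p + fst q, (snd p + snd q) mod int n)"
  by (cases p; cases q) (simp add: integer_mod_group_def)

lemma carrier_int_cyl: "0 < n \<Longrightarrow> carrier (int_cyl n) = UNIV \<times> {0..<int n}"
  by (simp add: carrier_integer_mod_group)

lemma add_mod_cancel_left:
  fixes a c d m :: int
  assumes "(a + c) mod m = (a + d) mod m" "c \<in> {0..<m}" "d \<in> {0..<m}"
  shows "c = d"
proof -
  have "c mod m = d mod m"
    using mod_diff_cong[OF assms(1) refl[of "a mod m"]] by simp
  then show ?thesis using assms(2,3) by simp
qed

text \<open>Two different pairs with the same sum have no element in common, so they span four elements.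
  In the remaining case \<open>Y = {0, 1, 2, 3}\<close>, the value \<open>2\<close> is otherwise only a sum of equal elements,
  namely \<open>1 + 1\<close> and \<open>3 + 3\<close>.\<close>

lemma exists_unique_pair_sum_mod:
  assumes n: "0 < n" "n \<le> 4" and Y: "Y \<subseteq> {0..<int n}" and card: "2 \<le> card Y"
  shows "\<exists>a\<in>Y. \<exists>b\<in>Y. a \<noteq> b \<and>
    (\<forall>c\<in>Y. \<forall>d\<in>Y. c \<noteq> d \<longrightarrow> (c + d) mod int n = (a + b) mod int n \<longrightarrow> {c, d} = {a, b})"
proof (cases "card Y < 4")
  case True
  have fin: "finite Y" using Y finite_subset by blast
  obtain a b where ab: "a \<in> Y" "b \<in> Y" "a \<noteq> b"
    using card card_le_Suc0_iff_eq[OF fin] by fastforce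
  have "{c, d} = {a, b}"
    if cd: "c \<in> Y" "d \<in> Y" "c \<noteq> d" and eq: "(c + d) mod int n = (a + b) mod int n" for c d
  proof (rule ccontr)
    assume ne: "{c, d} \<noteq> {a, b}"
    have cancel: "v = w"
      if "u \<in> Y" "v \<in> Y" "w \<in> Y" "(u + v) mod int n = (u + w) mod int n" for u v w
      using add_mod_cancel_left[OF that(4)] that Y by blast
    have "c \<noteq> a" using cancel[of a d b] eq ne ab cd by auto
    moreover have "c \<noteq> b" using cancel[of b d a] eq ne ab cd by (auto simp: add.commute[of a b])
    moreover have "d \<noteq> a" using cancel[of a c b] eq ne ab cd by (auto simp: add.commute[of c a])
    moreover have "d \<noteq> b" using cancel[of b c a] eq ne ab cd
      by (auto simp: add.commute[of c b] add.commute[of a b])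
    ultimately have "card {a, b, c, d} = 4" using ab cd by simp
    moreover have "card {a, b, c, d} \<le> card Y" using ab cd by (intro card_mono fin) blast
    ultimately show False using True by linarith
  qed
  then show ?thesis using ab by blast
next
  case False
  have "card Y \<le> n" using card_mono[OF _ Y] by simp
  then have n4: "n = 4" and "card Y = card {0..<int n}" using False n by simp_all
  then have "Y = {0..<4}" using card_subset_eq[OF _ Y] by simp
  also have "\<dots> = {0, 1, 2, 3}" by auto
  finally have Y4: "Y = {0, 1, 2, 3}" .
  show ?thesis
    by (rule bexI[of _ 0], rule bexI[of _ 2]) (auto simp: Y4 n4)
qed

lemma uniquely_representedI:
  assumes "p \<in> A" "q \<in> A" "p \<noteq> q"
    and "\<And>r s. \<lbrakk>r \<in> A; s \<in> A; r \<noteq> s; r \<otimes>\<^bsub>int_cyl n\<^esub> s = p \<otimes>\<^bsub>int_cyl n\<^esub> q\<rbrakk> \<Longrightarrow> {r, s} = {p, q}"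
  shows "uniquely_represented n A (p \<otimes>\<^bsub>int_cyl n\<^esub> q)"
  unfolding uniquely_represented_def using assms by (intro ex1I[of _ "{p, q}"]) blast+

text \<open>One summand of the witness is taken from the top layer: since sizes are positive, this alone
  puts the sum above \<open>A\<close>, and it leaves few other sums of the same size.\<close>

lemma exists_ulam_candidate:
  assumes n: "0 < n" "n \<le> 4" and fin: "finite A" and carr: "A \<subseteq> carrier (int_cyl n)"
    and pos: "\<forall>p\<in>A. 0 < fst p" and card: "2 \<le> card A"
  shows "\<exists>z. ulam_candidate n A z"
proof -
  define M where "M = Max (fst ` A)"
  define Y where "Y = {y. (M, y) \<in> A}"
  have le_M: "fst p \<le> M" if "p \<in> A" for p using that fin by (simp add: M_def)
  have "M \<in> fst ` A" unfolding M_def using fin card by (intro Max_in) auto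
  then obtain y where y: "(M, y) \<in> A" by force
  have snd: "snd p \<in> {0..<int n}" if "p \<in> A" for p
    using that carr carrier_int_cyl[OF n(1)] by auto
  have Y: "Y \<subseteq> {0..<int n}" using snd by (force simp: Y_def)
  have finY: "finite Y" using Y finite_subset by blast
  have "\<exists>p\<in>A. \<exists>q\<in>A. p \<noteq> q \<and> fst p = M \<and>
    (\<forall>r\<in>A. \<forall>s\<in>A. r \<noteq> s \<longrightarrow> r \<otimes>\<^bsub>int_cyl n\<^esub> s = p \<otimes>\<^bsub>int_cyl n\<^esub> q \<longrightarrow> {r, s} = {p, q})"
  proof (cases "2 \<le> card Y")
    case True
    then obtain a b where ab: "a \<in> Y" "b \<in> Y" "a \<noteq> b"
      and uniq: "\<And>c d. \<lbrakk>c \<in> Y; d \<in> Y; c \<noteq> d; (c + d) mod int n = (a + b) mod int n\<rbrakk>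
        \<Longrightarrow> {c, d} = {a, b}"
      using exists_unique_pair_sum_mod[OF n Y] by meson
    have "\<forall>r\<in>A. \<forall>s\<in>A. r \<noteq> s \<longrightarrow>
      r \<otimes>\<^bsub>int_cyl n\<^esub> s = (M, a) \<otimes>\<^bsub>int_cyl n\<^esub> (M, b) \<longrightarrow> {r, s} = {(M, a), (M, b)}"
    proof (intro ballI impI)
      fix r s
      assume rs: "r \<in> A" "s \<in> A" "r \<noteq> s"
        and eq: "r \<otimes>\<^bsub>int_cyl n\<^esub> s = (M, a) \<otimes>\<^bsub>int_cyl n\<^esub> (M, b)"
      have sum: "fst r + fst s = M + M" "(snd r + snd s) mod int n = (a + b) mod int n"
        using eq by (simp_all add: mult_int_cyl n)
      \<comment> \<open>No element is larger than \<open>M\<close>, so a total size of \<open>2 * M\<close> forces both summands to the top.\<close>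
      then have "fst r = M" "fst s = M" using le_M[OF rs(1)] le_M[OF rs(2)] by linarith+
      then obtain c d where cd: "r = (M, c)" "s = (M, d)" by (metis prod.collapse)
      then have "{c, d} = {a, b}" using uniq[of c d] rs sum by (simp add: Y_def)
      then have "Pair M ` {c, d} = Pair M ` {a, b}" by simp
      then show "{r, s} = {(M, a), (M, b)}" using cd by simp
    qed
    moreover have "(M, a) \<in> A" "(M, b) \<in> A" "(M, a) \<noteq> (M, b)" "fst (M, a) = M"
      using ab by (simp_all add: Y_def)
    ultimately show ?thesis by blast
  next
    case False
    then have "card Y \<le> Suc 0" by simp
    then have top: "p = (M, y)" if "p \<in> A" "fst p = M" for p
      using that y card_le_Suc0_iff_eq[OF finY] by (cases p) (auto simp: Y_def)
    define B where "B = A - {(M, y)}"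
    have "card B = card A - 1" using y by (simp add: B_def)
    then have "B \<noteq> {}" using card by auto
    moreover have "finite B" using fin by (simp add: B_def)
    ultimately have "Max (fst ` B) \<in> fst ` B" "\<And>r. r \<in> B \<Longrightarrow> fst r \<le> Max (fst ` B)"
      by (auto intro: Max_in)
    then obtain q where q: "q \<in> B" and le_q: "\<And>r. r \<in> B \<Longrightarrow> fst r \<le> fst q" by auto
    have qA: "q \<in> A" "q \<noteq> (M, y)" using q by (auto simp: B_def)
    have "fst q < M" using le_M[OF qA(1)] top[OF qA(1)] qA(2) by fastforce
    \<comment> \<open>Other elements may share the size of \<open>q\<close>; the second coordinate of the sum excludes them.\<close>
    have second: "s = q" if "s \<in> A" "(M, y) \<otimes>\<^bsub>int_cyl n\<^esub> s = (M, y) \<otimes>\<^bsub>int_cyl n\<^esub> q" for s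
    proof (rule prod_eqI)
      show "fst s = fst q" using that(2) by (simp add: mult_int_cyl n)
      show "snd s = snd q"
        by (rule add_mod_cancel_left[of y _ "int n"])
          (use that qA snd in \<open>simp_all add: mult_int_cyl n\<close>)
    qed
    have "\<forall>r\<in>A. \<forall>s\<in>A. r \<noteq> s \<longrightarrow>
      r \<otimes>\<^bsub>int_cyl n\<^esub> s = (M, y) \<otimes>\<^bsub>int_cyl n\<^esub> q \<longrightarrow> {r, s} = {(M, y), q}"
    proof (intro ballI impI)
      fix r s
      assume rs: "r \<in> A" "s \<in> A" "r \<noteq> s"
        and eq: "r \<otimes>\<^bsub>int_cyl n\<^esub> s = (M, y) \<otimes>\<^bsub>int_cyl n\<^esub> q"
      have sum: "fst r + fst s = M + fst q" using eq by (simp add: mult_int_cyl n)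
      have "r = (M, y) \<or> s = (M, y)"
      proof (rule ccontr)
        assume "\<not> ?thesis"
        then have "fst r \<le> fst q" "fst s \<le> fst q" using rs le_q by (auto simp: B_def)
        then show False using sum \<open>fst q < M\<close> by linarith
      qed
      then show "{r, s} = {(M, y), q}"
      proof
        assume "r = (M, y)"
        then show "{r, s} = {(M, y), q}" using second[of s] rs eq by simp
      next
        assume s: "s = (M, y)"
        then have "(M, y) \<otimes>\<^bsub>int_cyl n\<^esub> r = (M, y) \<otimes>\<^bsub>int_cyl n\<^esub> q"
          using eq by (simp add: mult_int_cyl n add.commute)
        then show "{r, s} = {(M, y), q}" using second[of r] rs s by auto
      qed
    qed
    moreover have "(M, y) \<noteq> q" "fst (M, y) = M" using qA(2) by simp_all
    ultimately show ?thesis using y qA(1) by blast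
  qed
  then obtain p q where pq: "p \<in> A" "q \<in> A" "p \<noteq> q" "fst p = M"
    and uniq: "\<forall>r\<in>A. \<forall>s\<in>A. r \<noteq> s \<longrightarrow>
      r \<otimes>\<^bsub>int_cyl n\<^esub> s = p \<otimes>\<^bsub>int_cyl n\<^esub> q \<longrightarrow> {r, s} = {p, q}"
    by (elim bexE conjE)
  have "uniquely_represented n A (p \<otimes>\<^bsub>int_cyl n\<^esub> q)"
    by (rule uniquely_representedI[OF pq(1-3)]) (rule uniq[rule_format])
  moreover have "p \<otimes>\<^bsub>int_cyl n\<^esub> q \<notin> A"
  proof
    assume "p \<otimes>\<^bsub>int_cyl n\<^esub> q \<in> A"
    then have "fst p + fst q \<le> M" using le_M by (force simp: mult_int_cyl n)
    then show False using pos pq(2,4) by fastforce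
  qed
  moreover have "p \<otimes>\<^bsub>int_cyl n\<^esub> q \<in> carrier (int_cyl n)"
    using n by (simp only: mult_int_cyl carrier_int_cyl) simp
  ultimately show ?thesis unfolding ulam_candidate_def by blast
qed

lemma ulam_step_invariant:
  assumes "ulam_step n A B" "A \<subseteq> carrier (int_cyl n)" "\<forall>p\<in>A. 0 < fst p"
  shows "A \<subseteq> B \<and> B \<subseteq> carrier (int_cyl n) \<and> (\<forall>p\<in>B. 0 < fst p)"
proof (cases "\<exists>z. ulam_candidate n A z")
  case True
  then obtain z where "ulam_candidate n A z" "B = insert z A"
    using assms(1) by (auto simp: ulam_step_def is_arg_min_def)
  then show ?thesis using assms ulam_candidate_pos by (auto simp: ulam_candidate_def)
next
  case False
  then show ?thesis using assms by (simp add: ulam_step_def)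
qed

lemma ulam_step_strict:
  assumes "ulam_step n A B" "ulam_candidate n A z"
  shows "B \<noteq> A"
  using assms by (auto simp: ulam_step_def is_arg_min_def ulam_candidate_def split: if_splits)

theorem corollary4p15:
  fixes n :: nat and S U :: "(int \<times> int) set"
  assumes "n \<in> {2, 3, 4}"
    and "card S \<ge> 2"
    and "ulam_set n S U"
  shows "infinite U"
proof
  assume finU: "finite U"
  obtain T where init: "ulam_initial n S" and T: "T 0 = S"
    "\<And>k. ulam_step n (T k) (T (Suc k))" "U = (\<Union>k. T k)"
    using assms(3) unfolding ulam_set_def by blast
  have inv: "T k \<subseteq> carrier (int_cyl n) \<and> (\<forall>p\<in>T k. 0 < fst p)" for k
  proof (induction k)
    case 0
    then show ?case using init T(1) by (simp add: ulam_initial_def)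
  next
    case (Suc k)
    then show ?case using ulam_step_invariant[OF T(2)[of k]] by blast
  qed
  have mono: "T k \<subseteq> T (Suc k)" for k using ulam_step_invariant[OF T(2)[of k]] inv by blast
  have finT: "finite (T k)" for k using finU T(3) by (auto intro: finite_subset)
  \<comment> \<open>Every step adds an element, so the stage \<open>T (card U)\<close> would already be larger than \<open>U\<close>.\<close>
  have "k + 2 \<le> card (T k)" for k
  proof (induction k)
    case 0
    then show ?case using assms(2) T(1) by simp
  next
    case (Suc k)
    then obtain z where "ulam_candidate n (T k) z"
      using exists_ulam_candidate[of n "T k"] assms(1) finT inv by fastforce
    then have "T k \<subset> T (Suc k)" using ulam_step_strict[OF T(2)] mono by blast
    then have "card (T k) < card (T (Suc k))" by (rule psubset_card_mono[OF finT])
    then show ?case using Suc by simp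
  qed
  from this[of "card U"] have "card U < card (T (card U))" by linarith
  moreover have "card (T (card U)) \<le> card U" using finU T(3) by (intro card_mono) auto
  ultimately show False by simp
qed

end
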